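(* Let $\mathcal{A}$ be a C$^*$-algebra and let $A,B\in\mathcal{A}$. Then $A^*B=0$ if and only if $$\|AX\|\le\|AX+BY\|\quad\text{for all } X,Y\in\mathcal{A}.$$ *)

theory Defs
  imports "HOL-Analysis.Analysis"
begin

text \<open>
  Neither a unit nor nontriviality is assumed: \<open>real_normed_algebra\<close> provides an associative algebra
  with submultiplicative norm, and \<open>banach\<close> its completeness. The axiom \<open>scaleC_of_real\<close> ties the
  complex scalar multiplication to the real one that comes with these classes.
\<close>

class cstar_algebra = real_normed_algebra + banach +
  fixes scaleC :: "complex \<Rightarrow> 'a \<Rightarrow> 'a" (infixr "*\<^sub>C" 75)
    and star :: "'a \<Rightarrow> 'a" ("(_\<^sup>\<star>)" [1000] 999)
  assumes scaleC_of_real: "complex_of_real r *\<^sub>C x = r *\<^sub>R x"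
    and scaleC_add_right: "c *\<^sub>C (x + y) = c *\<^sub>C x + c *\<^sub>C y"
    and scaleC_add_left: "(c + d) *\<^sub>C x = c *\<^sub>C x + d *\<^sub>C x"
    and scaleC_scaleC: "c *\<^sub>C (d *\<^sub>C x) = (c * d) *\<^sub>C x"
    and mult_scaleC_left: "(c *\<^sub>C x) * y = c *\<^sub>C (x * y)"
    and mult_scaleC_right: "x * (c *\<^sub>C y) = c *\<^sub>C (x * y)"
    and norm_scaleC: "norm (c *\<^sub>C x) = cmod c * norm x"
    and star_star: "(x\<^sup>\<star>)\<^sup>\<star> = x"
    and star_add: "(x + y)\<^sup>\<star> = x\<^sup>\<star> + y\<^sup>\<star>"
    and star_scaleC: "(c *\<^sub>C x)\<^sup>\<star> = cnj c *\<^sub>C x\<^sup>\<star>"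
    and star_mult: "(x * y)\<^sup>\<star> = y\<^sup>\<star> * x\<^sup>\<star>"
    and cstar_identity: "norm (x\<^sup>\<star> * x) = (norm x)^2"

instantiation complex :: cstar_algebra
begin

definition scaleC_complex :: "complex \<Rightarrow> complex \<Rightarrow> complex" where
  "scaleC_complex c x = c * x"

definition star_complex :: "complex \<Rightarrow> complex" where
  "star_complex x = cnj x"

instance
  by standard
    (auto simp: scaleC_complex_def star_complex_def scaleR_conv_of_real algebra_simps
      norm_mult power2_eq_square)

end

end

theory Submission
  imports Defs
begin

text \<open>
  If \<open>A\<^sup>\<star> * B = 0\<close> then \<open>(A * X)\<^sup>\<star> * (A * X + B * Y) = (A * X)\<^sup>\<star> * (A * X)\<close>, and the C*-identity gives
  \<open>\<parallel>A * X\<parallel>\<^sup>2 \<le> \<parallel>A * X\<parallel> * \<parallel>A * X + B * Y\<parallel>\<close>.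

  For the converse, pass to the multiplier algebra to have a unit, and scale to \<open>\<parallel>A\<parallel>, \<parallel>B\<parallel> \<le> 1\<close>. Put
  \<open>T = A\<^sup>\<star> * B * B\<^sup>\<star> * A\<close>. If \<open>X\<close> is a function of \<open>T\<close> that lives where \<open>T \<ge> \<delta>\<close>, then
  \<open>X * T * X \<ge> \<delta> X\<^sup>2 \<ge> \<delta> (A * X)\<^sup>\<star> * (A * X)\<close>, so that \<open>Y = - B\<^sup>\<star> * A * X\<close> shrinks \<open>\<parallel>A * X\<parallel>\<^sup>2\<close> by the factor
  \<open>1 - \<delta>\<close>. The hypothesis thus forces \<open>X\<close> to vanish, that is \<open>T \<le> \<delta>\<close>, for every \<open>\<delta> > 0\<close>. The positive
  part \<open>X\<close> of \<open>T - \<delta>\<close> is only needed approximately, as \<open>k + (T - \<delta>)\<close> with \<open>k\<^sup>2 = (T - \<delta>)\<^sup>2 + e\<close>, and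
  square roots of strictly positive elements come from the Banach fixed point theorem, so no
  spectral theory is involved.
\<close>

section \<open>Square roots and positive elements\<close>

text \<open>Unlike \<open>ring_1\<close>, the class \<open>monoid_mult\<close> admits \<open>1 = 0\<close>, which occurs for the multipliers of the
  zero algebra.\<close>

class unital_cstar_algebra = cstar_algebra + monoid_mult

section \<open>The involution and the norm\<close>

lemma star_zero [simp]: "(0::'a::cstar_algebra)\<^sup>\<star> = 0"
  using star_add[of 0 "0::'a"] by simp

lemma star_minus: "(- x :: 'a::cstar_algebra)\<^sup>\<star> = - x\<^sup>\<star>"
  using star_add[of x "- x"] by (simp add: eq_neg_iff_add_eq_0 add.commute)

lemma star_diff: "(x - y :: 'a::cstar_algebra)\<^sup>\<star> = x\<^sup>\<star> - y\<^sup>\<star>"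
  using star_add[of x "- y"] by (simp add: star_minus)

lemma star_scaleR: "(r *\<^sub>R x :: 'a::cstar_algebra)\<^sup>\<star> = r *\<^sub>R x\<^sup>\<star>"
  by (metis scaleC_of_real star_scaleC complex_cnj_complex_of_real)

lemma star_one [simp]: "(1::'a::unital_cstar_algebra)\<^sup>\<star> = 1"
  by (metis mult.right_neutral mult.left_neutral star_mult star_star)

lemmas star_simps = star_star star_add star_diff star_minus star_scaleR star_mult

lemma norm_star [simp]: "norm ((x::'a::cstar_algebra)\<^sup>\<star>) = norm x"
proof -
  have le: "norm y \<le> norm (y\<^sup>\<star>)" for y :: 'a
  proof (cases "norm y = 0")
    case False
    have "(norm y)\<^sup>2 \<le> norm (y\<^sup>\<star>) * norm y"
      by (metis cstar_identity norm_mult_ineq)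
    then show ?thesis using False by (simp add: power2_eq_square)
  qed auto
  from le[of x] le[of "x\<^sup>\<star>"] show ?thesis by (simp add: star_star)
qed

lemma star_eq_zero_iff [simp]: "(x::'a::cstar_algebra)\<^sup>\<star> = 0 \<longleftrightarrow> x = 0"
  by (metis norm_star norm_eq_zero)

lemma bounded_linear_star: "bounded_linear (star :: 'a::cstar_algebra \<Rightarrow> 'a)"
  by (rule bounded_linear_intro[where K = 1]) (auto simp: star_add star_scaleR)

lemma norm_square_self_adjoint:
  "(h::'a::cstar_algebra)\<^sup>\<star> = h \<Longrightarrow> norm (h * h) = (norm h)\<^sup>2"
  by (metis cstar_identity)

lemma norm_one_le: "norm (1::'a::unital_cstar_algebra) \<le> 1"
proof -
  have "(norm (1::'a))\<^sup>2 = norm (1::'a)"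
    using cstar_identity[of "1::'a"] by simp
  then show ?thesis by (auto simp: power2_eq_square)
qed

lemma norm_scaleR_one_le: "norm (r *\<^sub>R (1::'a::unital_cstar_algebra)) \<le> \<bar>r\<bar>"
  using norm_one_le[where 'a='a] by (simp add: mult_left_le)

lemma norm_add_scaleR_one_le:
  "norm (x + r *\<^sub>R (1::'a::unital_cstar_algebra)) \<le> norm x + \<bar>r\<bar>"
  using norm_triangle_ineq[of x "r *\<^sub>R 1"] norm_scaleR_one_le[of r, where 'a='a] by linarith

section \<open>Square roots by a contraction\<close>

text \<open>The iteration runs in a closed set of self-adjoint elements that commute with whatever
  commutes with \<open>a\<close>, so its fixed point inherits both properties.\<close>

lemma sqrt_one_minus:
  fixes a :: "'a::unital_cstar_algebra"
  assumes sa: "a\<^sup>\<star> = a" and a: "norm a < 1"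
  obtains s where "s\<^sup>\<star> = s" "norm s < 1" "(1 - s) * (1 - s) = 1 - a"
    "\<And>y. a * y = y * a \<Longrightarrow> s * y = y * s"
proof -
  \<comment> \<open>The radius \<open>1 - d\<close> is the smaller root of
    \<open>r = (norm a + r\<^sup>2) / 2\<close>: the ball is mapped into itself, and
    \<open>1 - d\<close> also serves as contraction constant.\<close>
  define d where "d = sqrt (1 - norm a)"
  have d: "0 < d" "d \<le> 1" "norm a = 1 - d\<^sup>2" using a by (auto simp: d_def)
  define S where "S = {s. s\<^sup>\<star> = s} \<inter> {s. norm s \<le> 1 - d} \<inter> (\<Inter>y\<in>{y. a * y = y * a}. {s. s * y = y * s})"
  \<comment> \<open>\<open>(1 - s)\<^sup>2 = 1 - a\<close> is the fixed point equation \<open>s = (a + s\<^sup>2) / 2\<close>.\<close>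
  define f where "f s = (1/2) *\<^sub>R (a + s * s)" for s
  have "closed S"
    unfolding S_def
    by (intro closed_Int closed_INT ballI closed_Collect_eq closed_Collect_le
        linear_continuous_on bounded_linear_star continuous_intros)
  then have "complete S" by (simp add: complete_eq_closed)
  moreover have "0 \<in> S" using d by (simp add: S_def)
  then have "S \<noteq> {}" by blast
  moreover have "f s \<in> S" if "s \<in> S" for s
  proof -
    from that have s: "s\<^sup>\<star> = s" "norm s \<le> 1 - d" "\<And>y. a * y = y * a \<Longrightarrow> s * y = y * s"
      by (auto simp: S_def)
    have "norm (f s) \<le> (norm a + norm s * norm s) / 2"
      unfolding f_def using norm_triangle_ineq[of a "s * s"] norm_mult_ineq[of s s] by simp
    also have "\<dots> \<le> (1 - d\<^sup>2 + (1 - d) * (1 - d)) / 2"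
      using s(2) d by (intro divide_right_mono add_mono mult_mono) auto
    also have "\<dots> = 1 - d" by (simp add: power2_eq_square field_simps)
    finally have "norm (f s) \<le> 1 - d" .
    moreover have "f s * y = y * f s" if "a * y = y * a" for y
      using that s(3)[OF that] unfolding f_def
      by (metis (no_types, lifting) distrib_left distrib_right mult.assoc mult_scaleR_left mult_scaleR_right)
    ultimately show ?thesis
      using s(1) sa by (auto simp: S_def) (simp add: f_def star_simps)
  qed
  moreover have "dist (f s) (f t) \<le> (1 - d) * dist s t" if "s \<in> S" "t \<in> S" for s t
  proof -
    have st: "norm s \<le> 1 - d" "norm t \<le> 1 - d" using that by (auto simp: S_def)
    have "f s - f t = (1/2) *\<^sub>R (s * (s - t) + (s - t) * t)"
      by (simp add: f_def algebra_simps)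
    then have "norm (f s - f t) \<le> (norm (s * (s - t)) + norm ((s - t) * t)) / 2"
      by (simp add: norm_triangle_ineq)
    also have "\<dots> \<le> (norm s * norm (s - t) + norm (s - t) * norm t) / 2"
      by (intro divide_right_mono add_mono norm_mult_ineq) auto
    also have "\<dots> \<le> ((1 - d) * norm (s - t) + norm (s - t) * (1 - d)) / 2"
      using st by (intro divide_right_mono add_mono mult_right_mono mult_left_mono) auto
    finally show ?thesis by (simp add: dist_norm algebra_simps)
  qed
  ultimately have "\<exists>!s\<in>S. f s = s"
    using d by (intro Banach_fix[where c = "1 - d"]) auto
  then obtain s where s: "s \<in> S" "f s = s" by blast
  have "s + s = a + s * s"
    using s(2) unfolding f_def by (metis scaleR_half_double scaleR_add_right)
  then have "(1 - s) * (1 - s) = 1 - a" by (simp add: algebra_simps)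
  with s(1) d show ?thesis
    by (intro that[of s]) (auto simp: S_def)
qed

section \<open>Positive elements\<close>

text \<open>A norm condition that expresses, for self-adjoint \<open>h\<close>, that the spectrum is
  nonnegative: it confines the spectrum to the interval from 0 to \<open>2 * r\<close>.\<close>

definition positive_element :: "'a::unital_cstar_algebra \<Rightarrow> bool" where
  "positive_element h \<longleftrightarrow> h\<^sup>\<star> = h \<and> (\<exists>r\<ge>0. norm (r *\<^sub>R 1 - h) \<le> r)"

lemma positive_element_star: "positive_element h \<Longrightarrow> h\<^sup>\<star> = h"
  by (simp add: positive_element_def)

lemma positive_element_diff_self_adjoint:
  "h\<^sup>\<star> = h \<Longrightarrow> norm h \<le> r \<Longrightarrow> positive_element (r *\<^sub>R 1 - h)"
  unfolding positive_element_def using norm_ge_zero[of h] 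
  by (intro conjI exI[of _ r]) (auto simp: star_simps simp del: norm_ge_zero)

lemma positive_element_add: "positive_element h \<Longrightarrow> positive_element k \<Longrightarrow> positive_element (h + k)"
  unfolding positive_element_def
proof (elim conjE exE, intro conjI)
  fix r s :: real
  assume *: "0 \<le> r" "norm (r *\<^sub>R 1 - h) \<le> r" "0 \<le> s" "norm (s *\<^sub>R 1 - k) \<le> s"
  have "norm ((r + s) *\<^sub>R 1 - (h + k)) \<le> r + s"
    using norm_triangle_ineq[of "r *\<^sub>R 1 - h" "s *\<^sub>R 1 - k"] * by (simp add: algebra_simps)
  then show "\<exists>r\<ge>0. norm (r *\<^sub>R 1 - (h + k)) \<le> r"
    using * by (intro exI[of _ "r + s"]) auto
qed (simp add: star_add)

lemma positive_element_scaleR: "positive_element h \<Longrightarrow> 0 \<le> c \<Longrightarrow> positive_element (c *\<^sub>R h)"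
  unfolding positive_element_def
proof (elim conjE exE, intro conjI)
  fix r :: real
  assume *: "0 \<le> r" "norm (r *\<^sub>R 1 - h) \<le> r" "0 \<le> c"
  have "norm ((c * r) *\<^sub>R 1 - c *\<^sub>R h) = c * norm (r *\<^sub>R 1 - h)"
    using *(3) by (metis abs_of_nonneg norm_scaleR scaleR_diff_right scaleR_scaleR)
  then show "\<exists>r\<ge>0. norm (r *\<^sub>R 1 - c *\<^sub>R h) \<le> r"
    using * by (intro exI[of _ "c * r"]) (auto intro: mult_left_mono)
qed (simp add: star_scaleR)

text \<open>Write \<open>h + e *\<^sub>R 1\<close> as \<open>(r + e) *\<^sub>R (1 - a)\<close>; the
  shift by \<open>e\<close> makes \<open>norm a \<le> r / (r + e)\<close> strictly less than
  1.\<close>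

lemma positive_element_sqrt:
  fixes h :: "'a::unital_cstar_algebra"
  assumes "positive_element h" "0 < e"
  obtains k where "positive_element k" "k * k = h + e *\<^sub>R 1" "\<And>y. h * y = y * h \<Longrightarrow> k * y = y * k"
proof -
  from assms obtain r where r: "0 \<le> r" "norm (r *\<^sub>R 1 - h) \<le> r" and h: "h\<^sup>\<star> = h"
    by (auto simp: positive_element_def)
  define a where "a = (1 / (r + e)) *\<^sub>R (r *\<^sub>R 1 - h)"
  have "norm a \<le> r / (r + e)"
    using r assms(2) by (simp add: a_def divide_right_mono)
  also have "\<dots> < 1" using r assms(2) by simp
  finally have "norm a < 1" .
  moreover have "a\<^sup>\<star> = a" by (simp add: a_def star_simps h)
  ultimately obtain s where s: "s\<^sup>\<star> = s" "norm s < 1" "(1 - s) * (1 - s) = 1 - a"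
    "\<And>y. a * y = y * a \<Longrightarrow> s * y = y * s"
    using sqrt_one_minus by blast
  have comm: "s * y = y * s" if "h * y = y * h" for y
    using that by (intro s(4)) (simp add: a_def algebra_simps)
  let ?k = "sqrt (r + e) *\<^sub>R (1 - s)"
  have "positive_element (1 - s)"
    using positive_element_diff_self_adjoint[of s 1] s by simp
  then have "positive_element ?k" using r assms(2) by (intro positive_element_scaleR) auto
  moreover have "?k * ?k = (r + e) *\<^sub>R (1 - a)"
    using r assms(2) by (simp add: s(3))
  then have "?k * ?k = h + e *\<^sub>R 1"
    using r assms(2) by (simp add: a_def scaleR_diff_right scaleR_add_left)
  moreover have "?k * y = y * ?k" if "h * y = y * h" for y
    using comm[OF that] by (simp add: algebra_simps)
  ultimately show ?thesis by (rule that)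
qed

text \<open>For \<open>w = h + \<i> *\<^sub>C k\<close> commutation gives
  \<open>w\<^sup>\<star> * w = h * h + k * k\<close>, and \<open>h\<close> is the real part of
  \<open>w\<close>.\<close>

lemma norm_le_sum_squares:
  fixes h k :: "'a::cstar_algebra"
  assumes "h\<^sup>\<star> = h" "k\<^sup>\<star> = k" "h * k = k * h"
  shows "(norm h)\<^sup>2 \<le> norm (h * h + k * k)"
proof -
  define w where "w = h + \<i> *\<^sub>C k"
  have i: "\<i> *\<^sub>C \<i> *\<^sub>C x = - x" "(- \<i>) *\<^sub>C \<i> *\<^sub>C x = x" for x :: 'a
    using scaleC_of_real[of "-1" x] scaleC_of_real[of 1 x] by (simp_all add: scaleC_scaleC)
  have mi: "(- \<i>) *\<^sub>C x = - (\<i> *\<^sub>C x)" for x :: 'a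
    using scaleC_add_left[of "\<i>" "-\<i>" x] scaleC_of_real[of 0 x] by (simp add: eq_neg_iff_add_eq_0 add.commute)
  have scaleC_diff: "\<i> *\<^sub>C (x - y) = \<i> *\<^sub>C x - \<i> *\<^sub>C y" for x y :: 'a
    using scaleC_add_right[of \<i> "x - y" y] by (simp add: eq_diff_eq)
  have ws: "w\<^sup>\<star> = h - \<i> *\<^sub>C k"
    by (simp add: w_def star_simps star_scaleC assms mi)
  have "w\<^sup>\<star> * w = h * h + k * k"
    unfolding ws by (simp add: w_def algebra_simps mult_scaleC_left mult_scaleC_right scaleC_diff i assms)
  then have "norm (h * h + k * k) = (norm w)\<^sup>2" by (metis cstar_identity)
  moreover have "2 *\<^sub>R h = w + w\<^sup>\<star>" unfolding ws by (simp add: w_def scaleR_2)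
  then have "2 * norm h \<le> norm w + norm w"
    using norm_triangle_ineq[of w "w\<^sup>\<star>"] by (metis norm_scaleR norm_star abs_numeral)
  ultimately show ?thesis by simp
qed

text \<open>The element \<open>r *\<^sub>R 1 - h * h\<close> has a root \<open>k\<close> commuting
  with \<open>h\<close>; since \<open>k * k + h * h = r *\<^sub>R 1\<close>, the previous lemma
  bounds \<open>norm k\<close>.\<close>

lemma positive_element_square:
  fixes h :: "'a::unital_cstar_algebra"
  assumes "h\<^sup>\<star> = h"
  shows "positive_element (h * h)" and "(norm h)\<^sup>2 < r \<Longrightarrow> norm (r *\<^sub>R 1 - h * h) \<le> r"
proof -
  have *: "norm (r *\<^sub>R 1 - h * h) \<le> r" if r: "(norm h)\<^sup>2 < r" for r
  proof -
    have r0: "0 < r" using r by (meson le_less_trans zero_le_power2)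
    have nh: "norm (h * h) = (norm h)\<^sup>2" using assms by (rule norm_square_self_adjoint)
    obtain s where s: "s\<^sup>\<star> = s" "(1 - s) * (1 - s) = 1 - (1 / r) *\<^sub>R (h * h)"
      "\<And>y. ((1 / r) *\<^sub>R (h * h)) * y = y * ((1 / r) *\<^sub>R (h * h)) \<Longrightarrow> s * y = y * s"
      by (rule sqrt_one_minus[of "(1 / r) *\<^sub>R (h * h)"])
        (use r r0 in \<open>auto simp: star_simps assms nh\<close>)
    define k where "k = sqrt r *\<^sub>R (1 - s)"
    have kk: "k * k = r *\<^sub>R 1 - h * h"
      using r0 by (simp add: k_def s(2)) (simp add: scaleR_diff_right)
    have "s * h = h * s" by (rule s(3)) (simp add: mult.assoc)
    then have "k * h = h * k" by (simp add: k_def algebra_simps)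
    moreover have ks: "k\<^sup>\<star> = k" by (simp add: k_def star_simps s(1))
    ultimately have "(norm k)\<^sup>2 \<le> norm (k * k + h * h)"
      using assms by (intro norm_le_sum_squares) auto
    also have "\<dots> \<le> r" using norm_scaleR_one_le[of r] r0 by (simp add: kk)
    finally show ?thesis using norm_square_self_adjoint[OF ks] by (simp add: kk)
  qed
  then show "(norm h)\<^sup>2 < r \<Longrightarrow> norm (r *\<^sub>R 1 - h * h) \<le> r" .
  have "(norm h)\<^sup>2 < (norm h)\<^sup>2 + 1" by simp
  from *[OF this] show "positive_element (h * h)"
    unfolding positive_element_def using assms
    by (intro conjI exI[of _ "(norm h)\<^sup>2 + 1"]) (auto simp: star_simps)
qed

text \<open>Frees the definition of positivity from its particular \<open>r\<close>: up to a small
  shift \<open>h\<close> is a square, and squares satisfy the bound for every larger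
  \<open>r\<close>.\<close>

lemma norm_diff_positive:
  fixes h :: "'a::unital_cstar_algebra"
  assumes "positive_element h" "norm h \<le> r"
  shows "norm (r *\<^sub>R 1 - h) \<le> r"
proof (rule field_le_epsilon)
  fix e :: real assume e: "0 < e"
  then have e3: "0 < e/3" by simp
  obtain k where k: "positive_element k" "k * k = h + (e/3) *\<^sub>R 1"
    using positive_element_sqrt[OF assms(1) e3] by blast
  have "(norm k)\<^sup>2 = norm (h + (e/3) *\<^sub>R 1)"
    using norm_square_self_adjoint[OF positive_element_star[OF k(1)]] by (simp add: k(2))
  also have "\<dots> \<le> norm h + e/3"
    using norm_add_scaleR_one_le[of h "e/3"] e by simp
  also have "\<dots> < r + 2*e/3" using assms(2) e by simp
  finally have "norm ((r + 2*e/3) *\<^sub>R 1 - k * k) \<le> r + 2*e/3"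
    by (rule positive_element_square(2)[OF positive_element_star[OF k(1)]])
  moreover have "r *\<^sub>R 1 - h = ((r + 2*e/3) *\<^sub>R 1 - k * k) - (e/3) *\<^sub>R 1"
    by (simp add: k(2) algebra_simps flip: scaleR_add_left)
  ultimately show "norm (r *\<^sub>R 1 - h) \<le> r + e"
    using norm_add_scaleR_one_le[of "(r + 2*e/3) *\<^sub>R 1 - k * k" "- (e/3)"] e by simp
qed

text \<open>The witness \<open>norm h\<close> works up to any error. Later positivity proofs may
  therefore add an arbitrarily small multiple of 1.\<close>

lemma positive_element_limit:
  fixes h :: "'a::unital_cstar_algebra"
  assumes "\<And>e. 0 < e \<Longrightarrow> positive_element (h + e *\<^sub>R 1)"
  shows "positive_element h"
proof -
  have "norm (norm h *\<^sub>R 1 - h) \<le> norm h"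
  proof (rule field_le_epsilon)
    fix e :: real assume e: "0 < e"
    have "norm (h + e *\<^sub>R 1) \<le> norm h + e"
      using norm_add_scaleR_one_le[of h e] e by simp
    from norm_diff_positive[OF assms[OF e] this]
    show "norm (norm h *\<^sub>R 1 - h) \<le> norm h + e" by (simp add: algebra_simps)
  qed
  moreover have "h\<^sup>\<star> = h"
    using positive_element_star[OF assms[of 1]] by (simp add: star_simps)
  ultimately show ?thesis unfolding positive_element_def by (intro conjI exI[of _ "norm h"]) auto
qed

text \<open>The shifted factors have commuting roots \<open>p\<close> and \<open>q\<close>, so their
  product is the square of the self-adjoint \<open>p * q\<close>.\<close>

lemma positive_element_mult:
  fixes h k :: "'a::unital_cstar_algebra"
  assumes "positive_element h" "positive_element k" "h * k = k * h"
  shows "positive_element (h * k)"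
proof (rule positive_element_limit)
  fix e :: real assume e: "0 < e"
  \<comment> \<open>Small enough that the cross terms
    \<open>d *\<^sub>R (h + k + d *\<^sub>R 1)\<close> created by the shifts have norm at most
    \<open>e\<close>.\<close>
  define d where "d = min 1 (e / (norm h + norm k + 1))"
  have nn: "0 < norm h + norm k + 1" using norm_ge_zero[of h] norm_ge_zero[of k] by linarith
  have d: "0 < d" "d * (norm h + norm k + d) \<le> e"
  proof -
    show "0 < d" using e nn by (simp add: d_def)
    have "d * (norm h + norm k + d) \<le> (e / (norm h + norm k + 1)) * (norm h + norm k + 1)"
      using \<open>0 < d\<close> nn by (intro mult_mono) (auto simp: d_def)
    then show "d * (norm h + norm k + d) \<le> e" using nn by simp
  qed
  obtain p where p: "positive_element p" "p * p = h + d *\<^sub>R 1" "\<And>y. h * y = y * h \<Longrightarrow> p * y = y * p"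
    using positive_element_sqrt[OF assms(1) d(1)] by blast
  obtain q where q: "positive_element q" "q * q = k + d *\<^sub>R 1" "\<And>y. k * y = y * k \<Longrightarrow> q * y = y * q"
    using positive_element_sqrt[OF assms(2) d(1)] by blast
  have pq: "q * p = p * q" using p(3)[OF assms(3)] by (intro q(3)) auto
  have "positive_element ((p * q) * (p * q))"
    using p(1) q(1) pq by (intro positive_element_square) (simp add: star_simps positive_element_star)
  also have "(p * q) * (p * q) = (p * p) * (q * q)" by (metis mult.assoc pq)
  finally have 1: "positive_element ((h + d *\<^sub>R 1) * (k + d *\<^sub>R 1))" by (simp add: p q)
  have "norm (d *\<^sub>R (h + k + d *\<^sub>R 1)) \<le> d * (norm h + norm k + d)"
    using d(1) norm_add_scaleR_one_le[of "h + k" d] norm_triangle_ineq[of h k] by simp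
  then have "positive_element (e *\<^sub>R 1 - d *\<^sub>R (h + k + d *\<^sub>R 1))"
    using d(2) assms by (intro positive_element_diff_self_adjoint) (auto simp: star_simps positive_element_star)
  from positive_element_add[OF 1 this] show "positive_element (h * k + e *\<^sub>R 1)"
    by (simp add: algebra_simps)
qed

text \<open>Both \<open>h\<close> and \<open>?n *\<^sub>R 1 - h\<close> are positive. Their shifted
  roots commute and their squares add up to a multiple of 1, which bounds
  \<open>norm p\<close>.\<close>

lemma norm_mono_positive:
  fixes h k :: "'a::unital_cstar_algebra"
  assumes "positive_element h" "positive_element k"
  shows "norm h \<le> norm (h + k)"
proof (rule field_le_epsilon)
  fix e :: real assume e: "0 < e"
  let ?n = "norm (h + k)"
  have "positive_element (?n *\<^sub>R 1 - (h + k) + k)"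
    using assms by (intro positive_element_add positive_element_diff_self_adjoint) (auto simp: star_simps positive_element_star)
  then have pos: "positive_element (?n *\<^sub>R 1 - h)" by simp
  from e have e3: "0 < e/3" by simp
  obtain p where p: "positive_element p" "p * p = h + (e/3) *\<^sub>R 1" "\<And>y. h * y = y * h \<Longrightarrow> p * y = y * p"
    using positive_element_sqrt[OF assms(1) e3] by blast
  obtain q where q: "positive_element q" "q * q = ?n *\<^sub>R 1 - h + (e/3) *\<^sub>R 1"
    "\<And>y. (?n *\<^sub>R 1 - h) * y = y * (?n *\<^sub>R 1 - h) \<Longrightarrow> q * y = y * q"
    using positive_element_sqrt[OF pos e3] by blast
  have "p * h = h * p" by (rule p(3)) simp
  then have "q * p = p * q" by (intro q(3)) (simp add: algebra_simps)
  then have "(norm p)\<^sup>2 \<le> norm (p * p + q * q)"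
    using positive_element_star[OF p(1)] positive_element_star[OF q(1)]
    by (intro norm_le_sum_squares) auto
  also have "p * p + q * q = (?n + 2*e/3) *\<^sub>R 1"
    by (simp add: p(2) q(2) algebra_simps flip: scaleR_add_left)
  also have "norm \<dots> \<le> ?n + 2*e/3"
    using norm_scaleR_one_le[of "?n + 2*e/3", where 'a='a] e by simp
  also have "(norm p)\<^sup>2 = norm (h + (e/3) *\<^sub>R 1)"
    using norm_square_self_adjoint[OF positive_element_star[OF p(1)]] by (simp add: p(2))
  finally show "norm h \<le> ?n + e"
    using norm_add_scaleR_one_le[of "h + (e/3) *\<^sub>R 1" "- (e/3)"] e by simp
qed


section \<open>Absolute values and the positivity of \<open>a\<^sup>\<star> * a\<close>\<close>

text \<open>Here \<open>k\<close> is a root of \<open>h * h + e *\<^sub>R 1\<close>, a regularised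
  absolute value; \<open>k + h\<close> and \<open>k - h\<close> stand for twice the positive and
  negative parts, with product \<open>e\<close> instead of 0.\<close>

lemma positive_element_abs:
  fixes h :: "'a::unital_cstar_algebra"
  assumes "h\<^sup>\<star> = h" "0 < e"
  obtains k where "positive_element k" "k * h = h * k" "(k - h) * (k + h) = e *\<^sub>R 1" "(k + h) * (k - h) = e *\<^sub>R 1"
proof -
  obtain k where k: "positive_element k" "k * k = h * h + e *\<^sub>R 1"
    "\<And>y. (h * h) * y = y * (h * h) \<Longrightarrow> k * y = y * k"
    using positive_element_sqrt[OF positive_element_square(1)[OF assms(1)] assms(2)] by blast
  have kh: "k * h = h * k" by (rule k(3)) (simp add: mult.assoc)
  show ?thesis
    by (rule that[of k]) (use k(1) kh in \<open>simp_all add: algebra_simps k(2)\<close>)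
qed

text \<open>Half the sum of the squares of \<open>y\<close> and \<open>z\<close>, which are the real
  and imaginary parts of \<open>x\<close> up to real factors.\<close>

lemma positive_element_star_mult_commuted:
  fixes x :: "'a::unital_cstar_algebra"
  shows "positive_element (x\<^sup>\<star> * x + x * x\<^sup>\<star>)"
proof -
  define y where "y = x + x\<^sup>\<star>"
  define z where "z = \<i> *\<^sub>C (x - x\<^sup>\<star>)"
  have i: "\<i> *\<^sub>C \<i> *\<^sub>C u = - u" for u :: 'a
    using scaleC_of_real[of "-1" u] by (simp add: scaleC_scaleC)
  have mi: "(- \<i>) *\<^sub>C u = \<i> *\<^sub>C (- u)" for u :: 'a
    using scaleC_of_real[of "-1" u] scaleC_scaleC[of \<i> "-1" u] by simp
  have "z\<^sup>\<star> = z" by (simp add: z_def star_simps star_scaleC mi)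
  moreover have "y\<^sup>\<star> = y" by (simp add: y_def star_simps add.commute)
  ultimately have "positive_element ((1/2) *\<^sub>R (y * y + z * z))"
    by (intro positive_element_scaleR positive_element_add positive_element_square) auto
  also have "z * z = - ((x - x\<^sup>\<star>) * (x - x\<^sup>\<star>))"
    by (simp add: z_def mult_scaleC_left mult_scaleC_right i)
  then have "y * y + z * z = 2 *\<^sub>R (x\<^sup>\<star> * x + x * x\<^sup>\<star>)"
    by (simp add: y_def algebra_simps scaleR_2)
  finally show ?thesis by simp
qed

text \<open>A quantitative form of the fact that \<open>x\<^sup>\<star> * x\<close> and \<open>x * x\<^sup>\<star>\<close> have the same spectrum away from
  \<open>0\<close>, so that they cannot have opposite signs.\<close>

lemma norm_le_of_opposite_signs:
  fixes x :: "'a::unital_cstar_algebra"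
  assumes "positive_element (\<eta> *\<^sub>R 1 - x\<^sup>\<star> * x)" "positive_element (x * x\<^sup>\<star> + \<eta> *\<^sub>R 1)" "0 \<le> \<eta>"
  shows "(norm x)\<^sup>2 \<le> 3 * \<eta>"
proof (cases "x = 0")
  case False
  define M where "M = (norm x)\<^sup>2"
  define w where "w = - (x\<^sup>\<star> * x)"
  have M: "0 < M" using False by (simp add: M_def)
  have w: "norm w = M" "w\<^sup>\<star> = w"
    by (simp_all add: w_def M_def cstar_identity star_simps)
  have "norm (x * x\<^sup>\<star>) = M" using cstar_identity[of "x\<^sup>\<star>"] by (simp add: star_simps M_def)
  then have "norm (x * x\<^sup>\<star> + \<eta> *\<^sub>R 1) \<le> M + \<eta>"
    using norm_add_scaleR_one_le[of "x * x\<^sup>\<star>" \<eta>] assms(3) by simp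
  from norm_diff_positive[OF assms(2) this]
  have *: "norm (M *\<^sub>R 1 - x * x\<^sup>\<star>) \<le> M + \<eta>" by (simp add: algebra_simps)
  \<comment> \<open>Moves the bound on \<open>x * x\<^sup>\<star>\<close> over to \<open>w\<close>.
    If \<open>w\<close> were positive, the left side would have norm \<open>2 * M\<^sup>2\<close>,
    yet it is at most \<open>M * (M + \<eta>)\<close>.\<close>
  have "M *\<^sub>R w + w * w = - (x\<^sup>\<star> * (M *\<^sub>R 1 - x * x\<^sup>\<star>) * x)"
    by (simp add: w_def algebra_simps)
  then have "norm (M *\<^sub>R w + w * w) \<le> norm (x\<^sup>\<star>) * norm (M *\<^sub>R 1 - x * x\<^sup>\<star>) * norm x"
    using norm_mult_ineq[of "x\<^sup>\<star> * (M *\<^sub>R 1 - x * x\<^sup>\<star>)" x]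
      mult_right_mono[OF norm_mult_ineq[of "x\<^sup>\<star>" "M *\<^sub>R 1 - x * x\<^sup>\<star>"] norm_ge_zero[of x]]
    by simp
  also have "\<dots> \<le> norm x * (M + \<eta>) * norm x"
    using * by (simp add: mult_left_mono mult_right_mono)
  finally have 1: "norm (M *\<^sub>R w + w * w) \<le> M * (M + \<eta>)"
    by (simp add: M_def power2_eq_square mult_ac)
  \<comment> \<open>Positive, and up to \<open>\<eta>\<close> terms the difference between
    \<open>M *\<^sub>R w + w * w\<close> and \<open>2 *\<^sub>R (w * w)\<close>.\<close>
  define D where "D = (w + \<eta> *\<^sub>R 1) * (M *\<^sub>R 1 - w)"
  have "positive_element D" unfolding D_def
    using assms(1) w
    by (intro positive_element_mult positive_element_diff_self_adjoint) (auto simp: w_def algebra_simps)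
  moreover have "positive_element (2 *\<^sub>R (w * w))"
    using w by (intro positive_element_scaleR positive_element_square) auto
  ultimately have "norm (2 *\<^sub>R (w * w)) \<le> norm (2 *\<^sub>R (w * w) + D)"
    by (intro norm_mono_positive)
  also have "2 *\<^sub>R (w * w) + D = (M *\<^sub>R w + w * w) - \<eta> *\<^sub>R w + (\<eta> * M) *\<^sub>R 1"
    by (simp add: D_def algebra_simps scaleR_2)
  also have "norm \<dots> \<le> norm ((M *\<^sub>R w + w * w) - \<eta> *\<^sub>R w) + \<eta> * M"
    using norm_add_scaleR_one_le[of "(M *\<^sub>R w + w * w) - \<eta> *\<^sub>R w" "\<eta> * M"] assms(3) M by simp
  also have "norm ((M *\<^sub>R w + w * w) - \<eta> *\<^sub>R w) \<le> norm (M *\<^sub>R w + w * w) + \<eta> * M"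
    using norm_triangle_ineq4[of "M *\<^sub>R w + w * w" "\<eta> *\<^sub>R w"] assms(3) by (simp add: w)
  finally have "2 * (M * M) \<le> M * (M + \<eta>) + \<eta> * M + \<eta> * M"
    using 1 norm_square_self_adjoint[OF w(2)] by (simp add: w power2_eq_square)
  then have "M * M \<le> M * (3 * \<eta>)" by (simp add: algebra_simps)
  then have "M \<le> 3 * \<eta>" using M by simp
  then show ?thesis by (simp add: M_def)
qed (use assms in simp)

text \<open>The C*-identity, used twice, handles the fourth power; one factor \<open>norm c\<close>
  is then cancelled.\<close>

lemma norm_power3_self_adjoint_le:
  fixes c :: "'a::cstar_algebra"
  assumes "c\<^sup>\<star> = c"
  shows "norm c ^ 3 \<le> norm (c * c * c)"
proof (cases "c = 0")
  case False
  have "norm c * norm c ^ 3 = norm (c * c * (c * c))"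
    using assms by (simp add: norm_square_self_adjoint star_simps power2_eq_square power3_eq_cube)
  also have "\<dots> = norm (c * (c * c * c))" by (simp add: mult.assoc)
  also have "\<dots> \<le> norm c * norm (c * c * c)" by (rule norm_mult_ineq)
  finally show ?thesis using False by simp
qed simp

text \<open>Twice the negative part, \<open>c = \<bar>h\<bar> - h\<close>, of \<open>h = a\<^sup>\<star> * a\<close>, with \<open>\<bar>h\<bar>\<close> regularised to
  \<open>k = sqrt (h\<^sup>2 + e\<^sup>2)\<close>, makes \<open>(a * c)\<^sup>\<star> * (a * c) = c * h * c\<close> negative up to \<open>O(e\<^sup>2)\<close>, which
  forces \<open>c\<close> to be small.\<close>

lemma positive_element_star_mult:
  fixes a :: "'a::unital_cstar_algebra"
  shows "positive_element (a\<^sup>\<star> * a)"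
proof (rule positive_element_limit)
  fix e' :: real assume "0 < e'"
  define e where "e = e' / 3"
  have e: "0 < e" using \<open>0 < e'\<close> by (simp add: e_def)
  define h where "h = a\<^sup>\<star> * a"
  have h: "h\<^sup>\<star> = h" by (simp add: h_def star_simps)
  obtain k where k: "positive_element k" "k * h = h * k" "(k + h) * (k - h) = (e * e) *\<^sub>R 1"
    using positive_element_abs[OF h mult_pos_pos[OF e e]] by blast
  define c where "c = k - h"
  have c: "c\<^sup>\<star> = c" using k(1) by (simp add: c_def star_simps h positive_element_star)
  have kc: "k * c = c * k" using k(2) by (simp add: c_def algebra_simps)
  have hc: "h * c = (e * e) *\<^sub>R 1 - k * c"
    using k(3) by (simp add: c_def algebra_simps)
  define x where "x = a * c"
  have "x\<^sup>\<star> * x = c * (h * c)" by (simp add: x_def h_def star_simps c mult.assoc)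
  also have "\<dots> = (e * e) *\<^sub>R c - k * (c * c)"
    by (simp add: hc right_diff_distrib kc[symmetric] flip: mult.assoc)
  finally have xx: "x\<^sup>\<star> * x = (e * e) *\<^sub>R c - k * (c * c)" .
  define \<eta> where "\<eta> = e * e * norm c"
  have \<eta>: "0 \<le> \<eta>" "norm ((e * e) *\<^sub>R c) = \<eta>" using e by (simp_all add: \<eta>_def)
  have "k * (c * c) = (c * c) * k" by (metis kc mult.assoc)
  then have "positive_element (k * (c * c))"
    by (rule positive_element_mult[OF k(1) positive_element_square(1)[OF c]])
  then have "positive_element ((\<eta> *\<^sub>R 1 - (e * e) *\<^sub>R c) + k * (c * c))"
    using \<eta> c by (intro positive_element_add positive_element_diff_self_adjoint) (auto simp: star_simps)
  then have neg: "positive_element (\<eta> *\<^sub>R 1 - x\<^sup>\<star> * x)" by (simp add: xx algebra_simps)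
  \<comment> \<open>As the sum of \<open>x\<^sup>\<star> * x\<close> and
    \<open>x * x\<^sup>\<star>\<close> is positive, an almost negative first term makes the second
    almost positive.\<close>
  from positive_element_add[OF neg positive_element_star_mult_commuted[of x]]
  have "positive_element (x * x\<^sup>\<star> + \<eta> *\<^sub>R 1)" by (simp add: algebra_simps)
  with neg \<eta> have "(norm x)\<^sup>2 \<le> 3 * \<eta>" by (intro norm_le_of_opposite_signs)
  then have nx: "norm (x\<^sup>\<star> * x) \<le> 3 * \<eta>" by (simp add: cstar_identity)
  \<comment> \<open>In this form \<open>(k + h) * c\<close> collapses to
    \<open>(e * e) *\<^sub>R 1\<close>, and \<open>k * (c * c)\<close> is known from
    \<open>xx\<close>.\<close>
  have "c * c * c = (2 *\<^sub>R k - (k + h)) * c * c" by (simp add: c_def scaleR_2)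
  also have "\<dots> = 2 *\<^sub>R (k * (c * c)) - ((k + h) * c) * c" by (simp add: algebra_simps)
  also have "\<dots> = (e * e) *\<^sub>R c - 2 *\<^sub>R (x\<^sup>\<star> * x)"
    using k(3) unfolding c_def[symmetric] by (simp add: xx scaleR_2)
  finally have "norm (c * c * c) \<le> \<eta> + 2 * norm (x\<^sup>\<star> * x)"
    using norm_triangle_ineq4[of "(e * e) *\<^sub>R c" "2 *\<^sub>R (x\<^sup>\<star> * x)"] \<eta> by simp
  \<comment> \<open>The bound is really \<open>7 * \<eta>\<close>; rounding up to 9 gives the
    perfect square \<open>(3 * e)\<^sup>2\<close>.\<close>
  also have "\<dots> \<le> 9 * \<eta>" using nx \<eta>(1) by simp
  finally have c3: "norm c * (norm c)\<^sup>2 \<le> norm c * (3 * e)\<^sup>2"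
    using norm_power3_self_adjoint_le[OF c] by (simp add: \<eta>_def power2_eq_square power3_eq_cube mult_ac)
  have "norm c \<le> 3 * e"
  proof (cases "c = 0")
    case False
    with c3 have "(norm c)\<^sup>2 \<le> (3 * e)\<^sup>2" by simp
    then show ?thesis by (rule power2_le_imp_le) (use e in simp)
  qed (use e in simp)
  with c have "positive_element ((3 * e) *\<^sub>R 1 - c)" by (rule positive_element_diff_self_adjoint)
  from positive_element_add[OF k(1) this] show "positive_element (a\<^sup>\<star> * a + e' *\<^sub>R 1)"
    by (simp add: c_def e_def h_def algebra_simps)
qed

text \<open>With \<open>q\<close> a root of \<open>p + d *\<^sub>R 1\<close>, the conjugate of the
  shifted element is \<open>(q * x)\<^sup>\<star> * (q * x)\<close>; the excess
  \<open>d *\<^sub>R (x\<^sup>\<star> * x)\<close> has norm at most \<open>e\<close>.\<close>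

lemma positive_element_conjugate:
  fixes p :: "'a::unital_cstar_algebra"
  assumes "positive_element p"
  shows "positive_element (x\<^sup>\<star> * p * x)"
proof (rule positive_element_limit)
  fix e :: real assume e: "0 < e"
  define d where "d = e / ((norm x)\<^sup>2 + 1)"
  have nn: "0 < (norm x)\<^sup>2 + 1" by (simp add: add_nonneg_pos)
  have d: "0 < d" using e nn by (simp add: d_def)
  have "d * (norm x)\<^sup>2 \<le> d * ((norm x)\<^sup>2 + 1)" using d by simp
  also have "\<dots> = e" using nn by (simp add: d_def)
  finally have "norm (d *\<^sub>R (x\<^sup>\<star> * x)) \<le> e" using d by (simp add: cstar_identity)
  then have *: "positive_element (e *\<^sub>R 1 - d *\<^sub>R (x\<^sup>\<star> * x))"
    by (intro positive_element_diff_self_adjoint) (simp add: star_simps)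
  obtain q where q: "positive_element q" "q * q = p + d *\<^sub>R 1"
    using positive_element_sqrt[OF assms d] by blast
  have "(q * x)\<^sup>\<star> * (q * x) = x\<^sup>\<star> * (q * q) * x"
    using q(1) by (simp add: star_simps positive_element_star mult.assoc)
  also have "\<dots> = x\<^sup>\<star> * p * x + d *\<^sub>R (x\<^sup>\<star> * x)" by (simp add: q algebra_simps)
  finally have "positive_element (x\<^sup>\<star> * p * x + d *\<^sub>R (x\<^sup>\<star> * x))"
    by (metis positive_element_star_mult)
  from positive_element_add[OF this *] show "positive_element (x\<^sup>\<star> * p * x + e *\<^sub>R 1)" by simp
qed

section \<open>The unital case\<close>

lemma star_mult_eq_zero_of_norm_le:
  fixes A B :: "'a::unital_cstar_algebra"
  assumes le: "\<And>X Y. norm (A * X) \<le> norm (A * X + B * Y)"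
    and A: "norm A \<le> 1" and B: "norm B \<le> 1"
  shows "A\<^sup>\<star> * B = 0"
proof -
  define T where "T = (B\<^sup>\<star> * A)\<^sup>\<star> * (B\<^sup>\<star> * A)"
  define S where "S = B * B\<^sup>\<star>"
  have T: "positive_element T" unfolding T_def by (rule positive_element_star_mult)
  have S: "positive_element S" "S\<^sup>\<star> = S"
    unfolding S_def using positive_element_star_mult[of "B\<^sup>\<star>"] by (simp_all add: star_simps)
  have "norm S = (norm B)\<^sup>2" using cstar_identity[of "B\<^sup>\<star>"] by (simp add: S_def star_simps)
  then have "norm S \<le> 1" using B by (simp add: power_le_one)
  then have S1: "positive_element (S * (1 - S))"
    using S positive_element_diff_self_adjoint[of S 1] by (intro positive_element_mult) (auto simp: algebra_simps)
  have A1: "positive_element (1 - A\<^sup>\<star> * A)"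
    using positive_element_diff_self_adjoint[of "A\<^sup>\<star> * A" 1] A
    by (simp add: star_simps cstar_identity power_le_one)
  have main: "norm T \<le> 2 * \<delta>" if \<delta>: "0 < \<delta>" "\<delta> < 1" for \<delta>
  proof -
    define d where "d = T - \<delta> *\<^sub>R 1"
    \<comment> \<open>Chosen so that \<open>2 * \<eta> = \<delta> ^ 3 * norm X\<close> below, which
      yields \<open>norm X \<le> \<delta>\<close>.\<close>
    define e where "e = \<delta> ^ 3 / 2"
    have e: "0 < e" using \<delta> by (simp add: e_def)
    have d: "d\<^sup>\<star> = d" using T by (simp add: d_def star_simps positive_element_star)
    obtain k where k: "positive_element k" "k * d = d * k" "(k - d) * (k + d) = e *\<^sub>R 1"
      using positive_element_abs[OF d e] by blast
    define X where "X = k + d"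
    have X: "X\<^sup>\<star> = X" "k * X = X * k" "d * X = X * d"
      using k(1,2) d by (simp_all add: X_def star_simps positive_element_star algebra_simps)
    have dX: "d * X = k * X - e *\<^sub>R 1"
      using k(3) unfolding X_def[symmetric] by (metis add_diff_cancel_left' diff_add_cancel left_diff_distrib add.commute)
    have XkX: "X * (k * X) = k * (X * X)" by (metis X(2) mult.assoc)
    have "X * T * X = X * (\<delta> *\<^sub>R X + d * X)" by (simp add: d_def algebra_simps)
    also have "\<dots> = \<delta> *\<^sub>R (X * X) + k * (X * X) - e *\<^sub>R X"
      by (simp add: dX XkX distrib_left right_diff_distrib)
    finally have XTX: "X * T * X = \<delta> *\<^sub>R (X * X) + k * (X * X) - e *\<^sub>R X" .
    have XX: "positive_element (X * X)" using X by (intro positive_element_square)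
    have "k * (X * X) = (X * X) * k" by (metis X(2) mult.assoc)
    with k(1) XX have kXX: "positive_element (k * (X * X))"
      by (rule positive_element_mult)
    define V where "V = A * X"
    define U where "U = V - S * V"
    \<comment> \<open>The only use of the hypothesis on \<open>A\<close> and
      \<open>B\<close>.\<close>
    have "norm V \<le> norm U"
      using le[of X "- (B\<^sup>\<star> * V)"] by (simp add: U_def S_def V_def mult.assoc)
    define \<eta> where "\<eta> = e * norm X"
    have \<eta>: "norm (e *\<^sub>R X) = \<eta>" "0 \<le> \<eta>" using e by (simp_all add: \<eta>_def)
    have pU: "positive_element (U\<^sup>\<star> * U)" by (rule positive_element_star_mult)
    \<comment> \<open>The slack that completes \<open>U\<^sup>\<star> * U\<close> to \<open>(1 -
      \<delta>) *\<^sub>R (V\<^sup>\<star> * V) + \<eta> *\<^sub>R 1\<close>. Its last summand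
      reflects \<open>(1 - S) * (1 - S) = 1 - S - S * (1 - S)\<close>.\<close>
    have "positive_element (\<delta> *\<^sub>R (X\<^sup>\<star> * (1 - A\<^sup>\<star> * A) * X) + k * (X * X)
        + (\<eta> *\<^sub>R 1 - e *\<^sub>R X) + V\<^sup>\<star> * (S * (1 - S)) * V)"
      using \<eta> X(1) kXX \<delta> A1 S1
      by (intro positive_element_add positive_element_scaleR positive_element_conjugate
          positive_element_diff_self_adjoint) (auto simp: star_simps)
    from norm_mono_positive[OF pU this]
    have "norm (U\<^sup>\<star> * U) \<le> norm (U\<^sup>\<star> * U + (\<delta> *\<^sub>R (X\<^sup>\<star> * (1 - A\<^sup>\<star> * A) * X) + k * (X * X)
        + (\<eta> *\<^sub>R 1 - e *\<^sub>R X) + V\<^sup>\<star> * (S * (1 - S)) * V))" (is "_ \<le> norm ?Z") .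
    also have "?Z = U\<^sup>\<star> * U + X * T * X - \<delta> *\<^sub>R (V\<^sup>\<star> * V) + \<eta> *\<^sub>R 1 + V\<^sup>\<star> * (S * (1 - S)) * V"
      unfolding XTX by (simp add: V_def X(1) star_simps algebra_simps)
    also have "X * T * X = V\<^sup>\<star> * S * V"
      by (simp add: V_def T_def S_def X(1) star_simps mult.assoc)
    also have "U\<^sup>\<star> * U + V\<^sup>\<star> * S * V - \<delta> *\<^sub>R (V\<^sup>\<star> * V) + \<eta> *\<^sub>R 1 + V\<^sup>\<star> * (S * (1 - S)) * V
        = (1 - \<delta>) *\<^sub>R (V\<^sup>\<star> * V) + \<eta> *\<^sub>R 1"
      by (simp add: U_def S(2) star_simps algebra_simps)
    also have "norm \<dots> \<le> (1 - \<delta>) * (norm V)\<^sup>2 + \<eta>"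
      using norm_add_scaleR_one_le[of "(1 - \<delta>) *\<^sub>R (V\<^sup>\<star> * V)" \<eta>] \<delta> \<eta>(2) by (simp add: cstar_identity)
    finally have "(norm U)\<^sup>2 \<le> (1 - \<delta>) * (norm V)\<^sup>2 + \<eta>" by (simp add: cstar_identity)
    moreover have "(norm V)\<^sup>2 \<le> (norm U)\<^sup>2" using \<open>norm V \<le> norm U\<close> by (intro power_mono) auto
    moreover have "(1 - \<delta>) * (norm V)\<^sup>2 = (norm V)\<^sup>2 - \<delta> * (norm V)\<^sup>2" by (simp add: algebra_simps)
    ultimately have dV: "\<delta> * (norm V)\<^sup>2 \<le> \<eta>" by linarith
    have "norm (B\<^sup>\<star> * V) \<le> norm B * norm V"
      using norm_mult_ineq[of "B\<^sup>\<star>" V] by simp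
    also have "\<dots> \<le> 1 * norm V" using B by (intro mult_right_mono) auto
    finally have BV: "(norm (B\<^sup>\<star> * V))\<^sup>2 \<le> (norm V)\<^sup>2" by (intro power_mono) auto
    \<comment> \<open>A reverse estimate: \<open>X * T * X\<close> is also
      \<open>(B\<^sup>\<star> * V)\<^sup>\<star> * (B\<^sup>\<star> * V)\<close>, so a small
      \<open>V\<close> forces a small \<open>X\<close>.\<close>
    have "\<delta> * (norm X)\<^sup>2 = norm (\<delta> *\<^sub>R (X * X))"
      using \<delta> norm_square_self_adjoint[OF X(1)] by simp
    also have "\<dots> \<le> norm (\<delta> *\<^sub>R (X * X) + k * (X * X))"
      using XX kXX \<delta> by (intro norm_mono_positive positive_element_scaleR) auto
    also have "\<delta> *\<^sub>R (X * X) + k * (X * X) = (B\<^sup>\<star> * V)\<^sup>\<star> * (B\<^sup>\<star> * V) + e *\<^sub>R X"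
      using XTX by (simp add: V_def T_def X(1) star_simps mult.assoc eq_diff_eq)
    also have "norm \<dots> \<le> (norm (B\<^sup>\<star> * V))\<^sup>2 + \<eta>"
      using norm_triangle_ineq[of "(B\<^sup>\<star> * V)\<^sup>\<star> * (B\<^sup>\<star> * V)" "e *\<^sub>R X"] by (simp only: cstar_identity \<eta>)
    finally have dX2: "\<delta> * (norm X)\<^sup>2 \<le> (norm V)\<^sup>2 + \<eta>" using BV by linarith
    have "norm X \<le> \<delta>"
    proof (cases "X = 0")
      case False
      have "\<delta> * (\<delta> * (norm X)\<^sup>2) \<le> \<delta> * (norm V)\<^sup>2 + \<delta> * \<eta>"
        using dX2 \<delta> by (simp flip: distrib_left)
      also have "\<dots> \<le> \<eta> + 1 * \<eta>"
        using dV \<delta> \<eta>(2) by (intro add_mono mult_right_mono) auto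
      also have "\<dots> = \<delta> ^ 3 * norm X" by (simp add: \<eta>_def e_def)
      finally have "(\<delta> * \<delta> * norm X) * norm X \<le> (\<delta> * \<delta> * norm X) * \<delta>"
        by (simp add: power2_eq_square power3_eq_cube mult_ac)
      then show ?thesis using \<delta> False by simp
    qed (use \<delta> in simp)
    moreover have "norm T \<le> norm (T + k)" using T k(1) by (rule norm_mono_positive)
    moreover have "T + k = X + \<delta> *\<^sub>R 1" by (simp add: X_def d_def)
    ultimately show ?thesis using norm_add_scaleR_one_le[of X \<delta>] \<delta> by simp
  qed
  have "norm T \<le> 0 + e" if e: "0 < e" for e
  proof -
    have "norm T \<le> 2 * min (1/2) (e/2)" using e by (intro main) auto
    then show ?thesis by simp
  qed
  then have "norm T \<le> 0" by (rule field_le_epsilon)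
  then have "(norm (B\<^sup>\<star> * A))\<^sup>2 = 0" by (simp add: T_def cstar_identity)
  then have "(B\<^sup>\<star> * A)\<^sup>\<star> = 0" by simp
  then show ?thesis by (simp add: star_simps)
qed


section \<open>The multiplier algebra\<close>

lift_definition scaleC_blinfun :: "complex \<Rightarrow> 'a::cstar_algebra \<Rightarrow>\<^sub>L 'a" is "scaleC"
proof -
  fix c :: complex
  have "c *\<^sub>C r *\<^sub>R x = r *\<^sub>R c *\<^sub>C x" for r and x :: 'a
    by (metis scaleC_of_real scaleC_scaleC mult.commute)
  then show "bounded_linear (scaleC c :: 'a \<Rightarrow> 'a)"
    by (intro bounded_linear_intro[where K = "cmod c"]) (auto simp: scaleC_add_right norm_scaleC)
qed

lift_definition mult_blinfun :: "'a::real_normed_algebra \<Rightarrow> 'a \<Rightarrow>\<^sub>L 'a" is "(*)"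
  by (rule bounded_linear_mult_right)

lifting_forget blinfun.lifting

lemma blinfun_eq_iff: "f = g \<longleftrightarrow> (\<forall>x. blinfun_apply f x = blinfun_apply g x)"
  by (auto intro: blinfun_eqI)

text \<open>A multiplier is a bounded operator together with its adjoint for the inner product \<open>x\<^sup>\<star> * y\<close>.\<close>

typedef (overloaded) ('a::cstar_algebra) multiplier =
  "{(f :: 'a \<Rightarrow>\<^sub>L 'a, g :: 'a \<Rightarrow>\<^sub>L 'a). \<forall>x y. (f x)\<^sup>\<star> * y = x\<^sup>\<star> * g y}"
  by (intro exI[of _ "(0, 0)"]) simp

setup_lifting type_definition_multiplier

lift_definition lact :: "'a::cstar_algebra multiplier \<Rightarrow> 'a \<Rightarrow>\<^sub>L 'a" is fst .
lift_definition ract :: "'a::cstar_algebra multiplier \<Rightarrow> 'a \<Rightarrow>\<^sub>L 'a" is snd .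

lemma star_lact: "(lact m x)\<^sup>\<star> * y = x\<^sup>\<star> * ract m y"
  by transfer auto

lemma star_ract: "(ract m x)\<^sup>\<star> * y = x\<^sup>\<star> * lact m y"
  using star_lact[of m y x] by (metis star_mult star_star)

lemma obtain_multiplier:
  fixes f g :: "'a::cstar_algebra \<Rightarrow>\<^sub>L 'a"
  assumes "\<And>x y. (f x)\<^sup>\<star> * y = x\<^sup>\<star> * g y"
  obtains m where "lact m = f" "ract m = g"
  using that[of "Abs_multiplier (f, g)"] assms
  by (simp add: lact.rep_eq ract.rep_eq Abs_multiplier_inverse)

text \<open>Test with \<open>x = z\<close>. This nondegeneracy makes adjoints unique.\<close>

lemma eq_zero_if_star_mult_eq_zero: "(\<And>x. x\<^sup>\<star> * z = 0) \<Longrightarrow> (z::'a::cstar_algebra) = 0"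
  by (metis cstar_identity norm_eq_zero zero_eq_power2)

text \<open>The adjoint is determined by the operator, so algebraic laws can be checked on
  \<open>lact\<close> alone.\<close>

lemma multiplier_eq_iff: "m = n \<longleftrightarrow> lact m = lact n"
proof
  assume eq: "lact m = lact n"
  have "ract m y = ract n y" for y
  proof -
    have "x\<^sup>\<star> * (ract m y - ract n y) = 0" for x
      using star_lact[of m x y] star_lact[of n x y] eq by (simp add: right_diff_distrib)
    then show ?thesis using eq_zero_if_star_mult_eq_zero by fastforce
  qed
  then have "ract m = ract n" by (rule blinfun_eqI)
  with eq show "m = n"
    by transfer (auto simp: prod_eq_iff)
qed simp

text \<open>The nontrivial half of the C*-identity for multipliers, from the one in the algebra
  applied to \<open>lact m x\<close>.\<close>

lemma lact_norm_square_le: "(norm (lact m))\<^sup>2 \<le> norm (ract m o\<^sub>L lact m)"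
proof -
  have "norm (lact m x) \<le> sqrt (norm (ract m o\<^sub>L lact m)) * norm x" for x
  proof (rule power2_le_imp_le)
    have "(norm (lact m x))\<^sup>2 = norm (x\<^sup>\<star> * (ract m o\<^sub>L lact m) x)"
      by (metis cstar_identity star_lact blinfun_apply_blinfun_compose)
    also have "\<dots> \<le> norm x * norm ((ract m o\<^sub>L lact m) x)"
      by (metis norm_mult_ineq norm_star)
    also have "\<dots> \<le> norm x * (norm (ract m o\<^sub>L lact m) * norm x)"
      by (intro mult_left_mono norm_blinfun) auto
    finally show "(norm (lact m x))\<^sup>2 \<le> (sqrt (norm (ract m o\<^sub>L lact m)) * norm x)\<^sup>2"
      by (simp add: power_mult_distrib) (simp add: power2_eq_square mult_ac)
  qed simp
  then have "norm (lact m) \<le> sqrt (norm (ract m o\<^sub>L lact m))"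
    by (intro norm_blinfun_bound) auto
  from power_mono[OF this, of 2] show ?thesis by simp
qed

lemma norm_lact_le_ract: "norm (lact m) \<le> norm (ract m)"
proof (cases "norm (lact m) = 0")
  case False
  have "norm (lact m) * norm (lact m) \<le> norm (ract m) * norm (lact m)"
    using lact_norm_square_le[of m] norm_blinfun_compose[of "ract m" "lact m"]
    by (simp add: power2_eq_square)
  with False show ?thesis by simp
qed auto

instantiation multiplier :: (cstar_algebra) real_normed_algebra
begin

lift_definition zero_multiplier :: "'a multiplier" is "(0, 0)" by simp
lift_definition plus_multiplier :: "'a multiplier \<Rightarrow> 'a multiplier \<Rightarrow> 'a multiplier"
  is "\<lambda>(f, g) (f', g'). (f + f', g + g')"
  by (auto simp: plus_blinfun.rep_eq star_add distrib_left distrib_right)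
lift_definition uminus_multiplier :: "'a multiplier \<Rightarrow> 'a multiplier"
  is "\<lambda>(f, g). (- f, - g)"
  by (auto simp: uminus_blinfun.rep_eq star_minus)
lift_definition minus_multiplier :: "'a multiplier \<Rightarrow> 'a multiplier \<Rightarrow> 'a multiplier"
  is "\<lambda>(f, g) (f', g'). (f - f', g - g')"
  by (auto simp: minus_blinfun.rep_eq star_diff left_diff_distrib right_diff_distrib)
lift_definition scaleR_multiplier :: "real \<Rightarrow> 'a multiplier \<Rightarrow> 'a multiplier"
  is "\<lambda>r (f, g). (r *\<^sub>R f, r *\<^sub>R g)"
  by (auto simp: scaleR_blinfun.rep_eq star_scaleR)
lift_definition times_multiplier :: "'a multiplier \<Rightarrow> 'a multiplier \<Rightarrow> 'a multiplier"
  is "\<lambda>(f, g) (f', g'). (f o\<^sub>L f', g' o\<^sub>L g)"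
  by auto

text \<open>Symmetric in the two components: \<open>norm_lact_le_ract\<close>, applied to a
  multiplier and its adjoint, makes their norms equal.\<close>

definition norm_multiplier :: "'a multiplier \<Rightarrow> real" where "norm_multiplier m = norm (lact m)"
definition dist_multiplier :: "'a multiplier \<Rightarrow> 'a multiplier \<Rightarrow> real"
  where "dist_multiplier m n = norm (m - n)"
definition sgn_multiplier :: "'a multiplier \<Rightarrow> 'a multiplier"
  where "sgn_multiplier m = inverse (norm m) *\<^sub>R m"
definition uniformity_multiplier :: "('a multiplier \<times> 'a multiplier) filter"
  where "uniformity_multiplier = (INF e\<in>{0<..}. principal {(x, y). dist x y < e})"
definition open_multiplier :: "'a multiplier set \<Rightarrow> bool"
  where "open_multiplier U \<longleftrightarrow> (\<forall>x\<in>U. \<forall>\<^sub>F (x', y) in uniformity. x' = x \<longrightarrow> y \<in> U)"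

lemma lact_simps [simp]:
  fixes m n :: "'a multiplier"
  shows "lact (0 :: 'a multiplier) = 0" "lact (m + n) = lact m + lact n" "lact (- m) = - lact m"
    "lact (m - n) = lact m - lact n" "lact (r *\<^sub>R m) = r *\<^sub>R lact m" "lact (m * n) = lact m o\<^sub>L lact n"
  by (transfer; auto)+

instance
proof
  fix m n p :: "'a multiplier" and r s :: real
  show "(m * n) * p = m * (n * p)"
    by (simp add: multiplier_eq_iff blinfun_eq_iff)
  show "(m + n) * p = m * p + n * p" "m * (n + p) = m * n + m * p"
    by (simp_all add: multiplier_eq_iff blinfun_eq_iff blinfun.bilinear_simps)
  show "(r *\<^sub>R m) * n = r *\<^sub>R (m * n)" "m * (r *\<^sub>R n) = r *\<^sub>R (m * n)"
    by (simp_all add: multiplier_eq_iff blinfun_eq_iff blinfun.bilinear_simps)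
  show "norm (m * n) \<le> norm m * norm n"
    by (simp add: norm_multiplier_def norm_blinfun_compose)
  show "norm (m + n) \<le> norm m + norm n"
    by (simp add: norm_multiplier_def norm_triangle_ineq)
qed (auto simp: multiplier_eq_iff norm_multiplier_def dist_multiplier_def sgn_multiplier_def
    uniformity_multiplier_def open_multiplier_def algebra_simps)

end

instance multiplier :: (cstar_algebra) banach
proof
  fix X :: "nat \<Rightarrow> 'a multiplier"
  assume X: "Cauchy X"
  \<comment> \<open>Makes the adjoints a Cauchy sequence too, so that the adjoint relation passes to
    the limits.\<close>
  have rl: "norm (ract m) \<le> norm (lact m)" for m :: "'a multiplier"
  proof -
    obtain n where "lact n = ract m" "ract n = lact m"
      using obtain_multiplier[of "ract m" "lact m"] star_ract by blast
    then show ?thesis using norm_lact_le_ract[of n] by simp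
  qed
  have ract_diff: "ract (m - n) = ract m - ract n" for m n :: "'a multiplier"
    by transfer auto
  have "dist (lact m) (lact n) \<le> dist m n" "dist (ract m) (ract n) \<le> dist m n" for m n :: "'a multiplier"
    using rl[of "m - n"] by (simp_all add: dist_norm norm_multiplier_def ract_diff)
  with X have "Cauchy (\<lambda>n. lact (X n))" "Cauchy (\<lambda>n. ract (X n))"
    unfolding Cauchy_def by (meson le_less_trans)+
  then obtain f g where f: "(\<lambda>n. lact (X n)) \<longlonglongrightarrow> f" and g: "(\<lambda>n. ract (X n)) \<longlonglongrightarrow> g"
    by (meson Cauchy_convergent convergent_def)
  have "(f x)\<^sup>\<star> * y = x\<^sup>\<star> * g y" for x y
  proof (rule LIMSEQ_unique)
    have "(\<lambda>n. (lact (X n) x)\<^sup>\<star>) \<longlonglongrightarrow> (f x)\<^sup>\<star>"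
      by (intro bounded_linear.tendsto[OF bounded_linear_star] blinfun.tendsto f tendsto_const)
    then show "(\<lambda>n. (lact (X n) x)\<^sup>\<star> * y) \<longlonglongrightarrow> (f x)\<^sup>\<star> * y"
      by (intro tendsto_mult tendsto_const)
    show "(\<lambda>n. (lact (X n) x)\<^sup>\<star> * y) \<longlonglongrightarrow> x\<^sup>\<star> * g y"
      unfolding star_lact by (intro tendsto_mult tendsto_const blinfun.tendsto g)
  qed
  then obtain m where "lact m = f" using obtain_multiplier by blast
  with f have "X \<longlonglongrightarrow> m"
    unfolding LIMSEQ_iff by (simp add: norm_multiplier_def)
  then show "convergent X" by (auto simp: convergent_def)
qed

instantiation multiplier :: (cstar_algebra) unital_cstar_algebra
begin

lift_definition one_multiplier :: "'a multiplier" is "(id_blinfun, id_blinfun)"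
  by simp
lift_definition scaleC_multiplier :: "complex \<Rightarrow> 'a multiplier \<Rightarrow> 'a multiplier"
  is "\<lambda>c (f, g). (scaleC_blinfun c o\<^sub>L f, scaleC_blinfun (cnj c) o\<^sub>L g)"
  by (auto simp: scaleC_blinfun.rep_eq star_scaleC mult_scaleC_left mult_scaleC_right)
lift_definition star_multiplier :: "'a multiplier \<Rightarrow> 'a multiplier"
  is "\<lambda>(f, g). (g, f)"
  by (auto, metis star_mult star_star)

lemma lact_scaleC [simp]: "lact (c *\<^sub>C m) x = c *\<^sub>C lact m x" for m :: "'a multiplier"
  by transfer (auto simp: scaleC_blinfun.rep_eq)

lemma lact_star [simp]: "lact (m\<^sup>\<star>) = ract m" for m :: "'a multiplier"
  by transfer auto

lemma lact_one [simp]: "lact (1 :: 'a multiplier) = id_blinfun"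
  by transfer auto

lemma ract_scaleC: "ract (c *\<^sub>C m) x = cnj c *\<^sub>C ract m x" for m :: "'a multiplier"
  by transfer (auto simp: scaleC_blinfun.rep_eq)

instance
proof
  fix m n :: "'a multiplier" and c d :: complex
  \<comment> \<open>The type only guarantees real linearity; having an adjoint forces complex
    linearity.\<close>
  have lact_mult_scaleC: "lact m (c *\<^sub>C x) = c *\<^sub>C lact m x" for x
  proof -
    have "(lact m (c *\<^sub>C x) - c *\<^sub>C lact m x) = 0"
      by (rule eq_zero_if_star_mult_eq_zero)
        (simp add: right_diff_distrib mult_scaleC_right flip: star_ract)
    then show ?thesis by simp
  qed
  show real_m: "complex_of_real r *\<^sub>C m = r *\<^sub>R m" for r
    by (simp add: multiplier_eq_iff blinfun_eq_iff scaleC_of_real scaleR_blinfun.rep_eq)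
  show "c *\<^sub>C (m + n) = c *\<^sub>C m + c *\<^sub>C n" "(c + d) *\<^sub>C m = c *\<^sub>C m + d *\<^sub>C m"
    by (simp_all add: multiplier_eq_iff blinfun_eq_iff plus_blinfun.rep_eq scaleC_add_right scaleC_add_left)
  show scaleC_scaleC_m: "c *\<^sub>C d *\<^sub>C m = (c * d) *\<^sub>C m" for c d
    by (simp add: multiplier_eq_iff blinfun_eq_iff scaleC_scaleC)
  show "(c *\<^sub>C m) * n = c *\<^sub>C (m * n)" "m * (c *\<^sub>C n) = c *\<^sub>C (m * n)"
    by (simp_all add: multiplier_eq_iff blinfun_eq_iff lact_mult_scaleC)
  have norm_le: "norm (a *\<^sub>C p) \<le> cmod a * norm p" for a and p :: "'a multiplier"
    unfolding norm_multiplier_def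
  proof (rule norm_blinfun_bound)
    show "norm (lact (a *\<^sub>C p) x) \<le> cmod a * norm (lact p) * norm x" for x
      using norm_blinfun[of "lact p" x] by (simp add: norm_scaleC mult.assoc mult_left_mono)
  qed simp
  show "norm (c *\<^sub>C m) = cmod c * norm m"
  proof (cases "c = 0")
    case False
    have "inverse c *\<^sub>C c *\<^sub>C m = complex_of_real 1 *\<^sub>C m" using False scaleC_scaleC_m by simp
    with norm_le[of "inverse c" "c *\<^sub>C m"] have "norm m \<le> inverse (cmod c) * norm (c *\<^sub>C m)"
      using real_m[of 1] by (simp add: norm_inverse)
    with norm_le[of c m] False show ?thesis by (simp add: field_simps)
  qed (use norm_le[of 0 m] in simp)
  show "(m\<^sup>\<star>)\<^sup>\<star> = m" "(m + n)\<^sup>\<star> = m\<^sup>\<star> + n\<^sup>\<star>" "(m * n)\<^sup>\<star> = n\<^sup>\<star> * m\<^sup>\<star>"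
    by (transfer; auto)+
  show "(c *\<^sub>C m)\<^sup>\<star> = cnj c *\<^sub>C m\<^sup>\<star>"
    by (simp add: multiplier_eq_iff blinfun_eq_iff ract_scaleC)
  show "1 * m = m" "m * 1 = m"
    by (simp_all add: multiplier_eq_iff blinfun_eq_iff)
  have "norm (m\<^sup>\<star> * m) \<le> norm (ract m) * norm m"
    by (simp add: norm_multiplier_def norm_blinfun_compose)
  also have "norm (ract m) \<le> norm m"
    using norm_lact_le_ract[of "m\<^sup>\<star>"] unfolding norm_multiplier_def lact_star 
    by (metis lact_star \<open>(m\<^sup>\<star>)\<^sup>\<star> = m\<close>)
  finally have "norm (m\<^sup>\<star> * m) \<le> (norm m)\<^sup>2"
    by (simp add: mult_right_mono power2_eq_square)
  moreover have "(norm m)\<^sup>2 \<le> norm (m\<^sup>\<star> * m)"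
    using lact_norm_square_le[of m] by (simp add: norm_multiplier_def)
  ultimately show "norm (m\<^sup>\<star> * m) = (norm m)\<^sup>2" by simp
qed

end

section \<open>Embedding the algebra into its multipliers\<close>

lift_definition of_element :: "'a::cstar_algebra \<Rightarrow> 'a multiplier"
  is "\<lambda>a. (mult_blinfun a, mult_blinfun (a\<^sup>\<star>))"
  by (simp add: mult_blinfun.rep_eq star_mult mult.assoc)

lemma lact_of_element [simp]: "lact (of_element a) x = a * x"
  by transfer (simp add: mult_blinfun.rep_eq)

lemma ract_of_element [simp]: "ract (of_element a) x = a\<^sup>\<star> * x"
  by transfer (simp add: mult_blinfun.rep_eq)

lemma norm_of_element_le: "norm (of_element a) \<le> norm a"
  unfolding norm_multiplier_def by (intro norm_blinfun_bound) (auto simp: norm_mult_ineq)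

text \<open>The norm inequality extends to multipliers \<open>X\<close> and \<open>Y\<close> because
  theirs is an operator norm: at each \<open>z\<close> it is the hypothesis for
  \<open>lact X z\<close> and \<open>lact Y z\<close>.\<close>

lemma star_mult_eq_zero_of_norm_le_nonunital:
  fixes A B :: "'a::cstar_algebra"
  assumes le: "\<And>X Y. norm (A * X) \<le> norm (A * X + B * Y)"
    and "norm A \<le> 1" "norm B \<le> 1"
  shows "A\<^sup>\<star> * B = 0"
proof -
  have "(of_element A)\<^sup>\<star> * of_element B = 0"
  proof (rule star_mult_eq_zero_of_norm_le)
    fix X Y :: "'a multiplier"
    show "norm (of_element A * X) \<le> norm (of_element A * X + of_element B * Y)"
      unfolding norm_multiplier_def[of "of_element A * X"]
    proof (rule norm_blinfun_bound)
      fix z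
      have "norm (lact (of_element A * X) z) \<le> norm (A * lact X z + B * lact Y z)"
        using le by simp
      also have "\<dots> = norm (lact (of_element A * X + of_element B * Y) z)"
        by (simp add: plus_blinfun.rep_eq)
      also have "\<dots> \<le> norm (of_element A * X + of_element B * Y) * norm z"
        unfolding norm_multiplier_def by (rule norm_blinfun)
      finally show "norm (lact (of_element A * X) z) \<le> norm (of_element A * X + of_element B * Y) * norm z" .
    qed simp
  qed (use assms norm_of_element_le order_trans in blast)+
  \<comment> \<open>Evaluation at this element stands in for evaluation at a unit and leads to the
    C*-identity.\<close>
  then have "lact ((of_element A)\<^sup>\<star> * of_element B) ((A\<^sup>\<star> * B)\<^sup>\<star>) = 0" by simp
  then have "(A\<^sup>\<star> * B) * (A\<^sup>\<star> * B)\<^sup>\<star> = 0" by (simp add: mult.assoc)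
  then have "(norm ((A\<^sup>\<star> * B)\<^sup>\<star>))\<^sup>2 = 0"
    using cstar_identity[of "(A\<^sup>\<star> * B)\<^sup>\<star>"] by (simp only: star_star norm_zero)
  then show ?thesis by simp
qed

theorem theorem5p2:
  fixes A B :: "'a::cstar_algebra"
  shows "A\<^sup>\<star> * B = 0 \<longleftrightarrow> (\<forall>X Y :: 'a. norm (A * X) \<le> norm (A * X + B * Y))"
proof (intro iffI allI)
  fix X Y :: 'a
  assume AB: "A\<^sup>\<star> * B = 0"
  have "(A * X)\<^sup>\<star> * (A * X + B * Y) = (A * X)\<^sup>\<star> * (A * X) + X\<^sup>\<star> * (A\<^sup>\<star> * B) * Y"
    by (simp add: star_mult distrib_left mult.assoc)
  then have "(norm (A * X))\<^sup>2 = norm ((A * X)\<^sup>\<star> * (A * X + B * Y))"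
    by (simp add: AB cstar_identity)
  also have "\<dots> \<le> norm (A * X) * norm (A * X + B * Y)"
    by (metis norm_mult_ineq norm_star)
  finally show "norm (A * X) \<le> norm (A * X + B * Y)"
    by (cases "norm (A * X) = 0") (auto simp: power2_eq_square)
next
  assume le: "\<forall>X Y :: 'a. norm (A * X) \<le> norm (A * X + B * Y)"
  \<comment> \<open>As \<open>inverse 0 = 0\<close>, the scaled elements have norm 1 or vanish; if
    one vanishes, so does \<open>A\<close> or \<open>B\<close>, and the goal is trivial.\<close>
  define a b where "a = inverse (norm A)" and "b = inverse (norm B)"
  have "(a *\<^sub>R A)\<^sup>\<star> * (b *\<^sub>R B) = 0"
  proof (rule star_mult_eq_zero_of_norm_le_nonunital)
    show "norm (a *\<^sub>R A * X) \<le> norm (a *\<^sub>R A * X + b *\<^sub>R B * Y)" for X Y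
      using le[rule_format, of "a *\<^sub>R X" "b *\<^sub>R Y"] by simp
  qed (auto simp: a_def b_def divide_simps)
  then show "A\<^sup>\<star> * B = 0"
    by (auto simp: star_scaleR a_def b_def)
qed

end
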